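(* Let $A,B\in\mathbb Z^{d\times d}$ be nonsingular and let $N_0\in\mathrm{PH}(B)$. Let $\mathfrak S_d=\bigsqcup_{i=1}^\ell\mathrm G(N_0)g_i$ be a right coset decomposition with respect to $\mathrm G(N_0)$. Then $A\simeq_{\mathrm{UP}}B$ $\iff$ $\mathrm H(A\cdot g_i^{-1})\in\mathrm O(N_0)$ for some $i\in\{1,\dots,\ell\}$ $\iff$ for some $i\in\{1,\dots,\ell\}$, $\mathrm G(\mathrm H(A\cdot g_i^{-1}))=\mathrm G(N_0)$ and $\min\mathrm O(\mathrm H(A\cdot g_i^{-1}))=N_0$ (minimum with respect to $\le_{\mathrm{rblex}}$).
   Context: $\mathrm H(M)$ is the Hermite normal form of nonsingular $M\in\mathbb Z^{d\times d}$ (unique $UM$, $U\in\mathrm{GL}_d(\mathbb Z)$, upper triangular with positive diagonal and off-diagonal entries nonnegative and strictly smaller than the diagonal entry of their column). For $\sigma\in\mathfrak S_d$, $P_\sigma=(\mathbf e_{\sigma(1)}|\cdots|\mathbf e_{\sigma(d)})$, $M\cdot\sigma=MP_\sigma$; $A\simeq_{\mathrm{UP}}B$ means $UA=B\cdot\sigma$ for some $U\in\mathrm{GL}_d(\mathbb Z)$, $\sigma\in\mathfrak S_d$. For $\mathbf r=(r_1<\dots<r_s)$ and $\mathbf m=(m_1,\dots,m_s)$ positive integers with $\sum m_i=d$, $\mathcal M(\mathbf r,\mathbf m)$ is the set of block upper-triangular integer matrices with diagonal blocks $r_iI_{m_i}$, zero blocks below, arbitrary blocks above. For $N\in\mathcal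 M(\mathbf r,\mathbf m)$, with $w_i=\{m_1+\dots+m_{i-1}+1,\dots,m_1+\dots+m_i\}$, the pattern group is $\mathrm G(N)=\mathfrak S_{w_1}\times\cdots\times\mathfrak S_{w_{s-1}}\le\mathfrak S_d$ and the orbit is $\mathrm O(N)=\{P_gNP_g^{-1}:g\in\mathrm G(N)\}$. For equal-size matrices, $X<_{\mathrm{rlex}}Y$ if at the first differing entry (rows top to bottom, within a row right to left) $X$'s entry is smaller. On $\mathcal M(\mathbf r,\mathbf m)$, $M<_{\mathrm{rblex}}M'$ if there is $k\in\{s-1,\dots,1\}$ such that the rows indexed by $w_l$ coincide for all $k<l\le s-1$ and the submatrix of rows indexed by $w_k$ of $M$ is $<_{\mathrm{rlex}}$ that of $M'$. $\mathrm{PH}(B)$ is the set of $N_0=\mathrm H(B\cdot g)$, $g\in\mathfrak S_d$, with $N_0\in\mathcal M(\mathbf r,\mathbf m)$ for some $\mathbf r,\mathbf m$, whose first positive entry in each row is $\le$ every other positive entry of that row, and which is the $\le_{\mathrm{rblex}}$-minimum of $\mathrm O(N_0)$. *)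

theory Defs
  imports
    "Jordan_Normal_Form.Determinant"
    "Jordan_Normal_Form.DL_Submatrix"
    "HOL-Combinatorics.Permutations"
    "HOL-Library.Disjoint_Sets"
begin

text \<open>
  Matrix indices are 0-based: rows, columns and permuted points range over \<open>{..<d}\<close>,
  and the blocks of a pattern are numbered \<open>0, \<dots>, s - 1\<close>.
\<close>

definition GL_int :: "nat \<Rightarrow> int mat set" where
  "GL_int d = {U \<in> carrier_mat d d. invertible_mat U}"

definition is_hermite :: "int mat \<Rightarrow> bool" where
  "is_hermite N \<longleftrightarrow> square_mat N \<and> upper_triangular N \<and>
     (\<forall>j<dim_col N. 0 < N $$ (j, j) \<and> (\<forall>i<j. 0 \<le> N $$ (i, j) \<and> N $$ (i, j) < N $$ (j, j)))"

definition hermite :: "int mat \<Rightarrow> int mat" where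
  "hermite M = (THE N. is_hermite N \<and> (\<exists>U \<in> GL_int (dim_row M). N = U * M))"

text \<open>Column \<open>j\<close> is the standard basis vector with index \<open>\<sigma> j\<close>.\<close>

definition perm_mat :: "nat \<Rightarrow> (nat \<Rightarrow> nat) \<Rightarrow> int mat" where
  "perm_mat d \<sigma> = mat d d (\<lambda>(i, j). if i = \<sigma> j then 1 else 0)"

definition perm_cols :: "int mat \<Rightarrow> (nat \<Rightarrow> nat) \<Rightarrow> int mat" where
  "perm_cols M \<sigma> = M * perm_mat (dim_col M) \<sigma>"

definition UP_equiv :: "nat \<Rightarrow> int mat \<Rightarrow> int mat \<Rightarrow> bool" where
  "UP_equiv d A B \<longleftrightarrow> (\<exists>U \<in> GL_int d. \<exists>\<sigma>. \<sigma> permutes {..<d} \<and> U * A = perm_cols B \<sigma>)"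

definition block :: "nat list \<Rightarrow> nat \<Rightarrow> nat set" where
  "block m k = {sum_list (take k m) ..< sum_list (take (Suc k) m)}"

text \<open>Empty unless \<open>r\<close> is a strictly increasing list of positive integers and \<open>m\<close> a list
  of positive integers of the same length.\<close>

definition block_mats :: "int list \<Rightarrow> nat list \<Rightarrow> int mat set" where
  "block_mats r m = {N \<in> carrier_mat (sum_list m) (sum_list m).
     length r = length m \<and> sorted_wrt (<) r \<and> (\<forall>x \<in> set r. 0 < x) \<and> (\<forall>x \<in> set m. 0 < x) \<and>
     (\<forall>k<length m. \<forall>i \<in> block m k. \<forall>j \<in> block m k. N $$ (i, j) = (if i = j then r ! k else 0)) \<and>
     (\<forall>k<length m. \<forall>l<k. \<forall>i \<in> block m k. \<forall>j \<in> block m l. N $$ (i, j) = 0)}"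

text \<open>The internal direct product of the symmetric groups of all blocks but the last one.\<close>

definition block_group :: "nat list \<Rightarrow> (nat \<Rightarrow> nat) set" where
  "block_group m = {g. g permutes (\<Union>k<length m - 1. block m k) \<and>
     (\<forall>k<length m - 1. g ` block m k = block m k)}"

definition has_pattern :: "int mat \<Rightarrow> bool" where
  "has_pattern N \<longleftrightarrow> (\<exists>r m. N \<in> block_mats r m)"

text \<open>The lists \<open>r\<close>, \<open>m\<close> are determined by the diagonal of \<open>N\<close>. A matrix without
  pattern gets the empty set, which is not the pattern group of any matrix with pattern.\<close>

definition pattern_group :: "int mat \<Rightarrow> (nat \<Rightarrow> nat) set" where
  "pattern_group N = {g. \<exists>r m. N \<in> block_mats r m \<and> g \<in> block_group m}"

text \<open>The inverse of the matrix of \<open>g\<close> is written as the matrix of the inverse permutation.\<close>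

definition orbit :: "int mat \<Rightarrow> int mat set" where
  "orbit N = {perm_mat (dim_row N) g * N * perm_mat (dim_row N) (Hilbert_Choice.inv g) | g.
     g \<in> pattern_group N}"

lemma perm_mat_inv:
  assumes "g permutes {..<d}"
  shows "perm_mat d g * perm_mat d (Hilbert_Choice.inv g) = 1\<^sub>m d"
    and "perm_mat d (Hilbert_Choice.inv g) * perm_mat d g = 1\<^sub>m d"
proof -
  have main: "perm_mat d h * perm_mat d (Hilbert_Choice.inv h) = 1\<^sub>m d"
    if h: "h permutes {..<d}" for h
  proof (rule eq_matI)
    fix i j assume ij: "i < dim_row (1\<^sub>m d :: int mat)" "j < dim_col (1\<^sub>m d :: int mat)"
    have lt: "Hilbert_Choice.inv h j < d"
      using permutes_in_image[OF permutes_inv[OF h], of j] ij by simp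
    have "(perm_mat d h * perm_mat d (Hilbert_Choice.inv h)) $$ (i, j) =
        (\<Sum>k<d. (if i = h k then 1 else 0) * (if k = Hilbert_Choice.inv h j then 1 else 0))"
      using ij by (simp add: perm_mat_def scalar_prod_def lessThan_atLeast0)
    also have "\<dots> = (\<Sum>k<d. if k = Hilbert_Choice.inv h j then (if i = h k then 1 else 0) else 0)"
      by (rule sum.cong) auto
    also have "\<dots> = (if i = h (Hilbert_Choice.inv h j) then 1 else 0)"
      using lt by (simp add: sum.delta)
    also have "\<dots> = (1\<^sub>m d :: int mat) $$ (i, j)"
      using ij by (simp add: permutes_inverses(1)[OF h])
    finally show "(perm_mat d h * perm_mat d (Hilbert_Choice.inv h)) $$ (i, j) = 1\<^sub>m d $$ (i, j)" .
  qed (simp_all add: perm_mat_def)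
  show "perm_mat d g * perm_mat d (Hilbert_Choice.inv g) = 1\<^sub>m d"
    by (rule main[OF assms])
  show "perm_mat d (Hilbert_Choice.inv g) * perm_mat d g = 1\<^sub>m d"
    using main[OF permutes_inv[OF assms]] by (simp add: permutes_inv_inv[OF assms])
qed

definition rlex_less :: "int mat \<Rightarrow> int mat \<Rightarrow> bool" where
  "rlex_less X Y \<longleftrightarrow> dim_row X = dim_row Y \<and> dim_col X = dim_col Y \<and>
     (\<exists>i<dim_row X. \<exists>j<dim_col X. X $$ (i, j) < Y $$ (i, j) \<and>
        (\<forall>i'<i. \<forall>j'<dim_col X. X $$ (i', j') = Y $$ (i', j')) \<and>
        (\<forall>j'<dim_col X. j < j' \<longrightarrow> X $$ (i, j') = Y $$ (i, j')))"

definition row_block :: "nat list \<Rightarrow> int mat \<Rightarrow> nat \<Rightarrow> int mat" where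
  "row_block m M k = submatrix M (block m k) UNIV"

definition rblex_less :: "int mat \<Rightarrow> int mat \<Rightarrow> bool" where
  "rblex_less M M' \<longleftrightarrow> (\<exists>r m. M \<in> block_mats r m \<and> M' \<in> block_mats r m \<and>
     (\<exists>k<length m - 1.
        (\<forall>l. k < l \<and> l < length m - 1 \<longrightarrow> row_block m M l = row_block m M' l) \<and>
        rlex_less (row_block m M k) (row_block m M' k)))"

definition is_rblex_min :: "int mat \<Rightarrow> int mat set \<Rightarrow> bool" where
  "is_rblex_min N S \<longleftrightarrow> N \<in> S \<and> (\<forall>X \<in> S. N = X \<or> rblex_less N X)"

definition first_pos_minimal :: "int mat \<Rightarrow> bool" where
  "first_pos_minimal N \<longleftrightarrow> (\<forall>i<dim_row N. \<forall>j<dim_col N.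
     0 < N $$ (i, j) \<and> (\<forall>j'<j. \<not> 0 < N $$ (i, j')) \<longrightarrow>
     (\<forall>j'<dim_col N. 0 < N $$ (i, j') \<longrightarrow> N $$ (i, j) \<le> N $$ (i, j')))"

definition PH :: "nat \<Rightarrow> int mat \<Rightarrow> int mat set" where
  "PH d B = {N\<^sub>0. (\<exists>g. g permutes {..<d} \<and> N\<^sub>0 = hermite (perm_cols B g)) \<and>
     has_pattern N\<^sub>0 \<and> first_pos_minimal N\<^sub>0 \<and> is_rblex_min N\<^sub>0 (orbit N\<^sub>0)}"

definition right_coset_decomposition ::
    "nat \<Rightarrow> (nat \<Rightarrow> nat) set \<Rightarrow> nat \<Rightarrow> (nat \<Rightarrow> nat \<Rightarrow> nat) \<Rightarrow> bool" where
  "right_coset_decomposition d G l g \<longleftrightarrow>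
     {p. p permutes {..<d}} = (\<Union>i \<in> {1..l}. (\<lambda>h. h \<circ> g i) ` G) \<and>
     disjoint_family_on (\<lambda>i. (\<lambda>h. h \<circ> g i) ` G) {1..l}"

end

theory Submission
  imports Defs
begin

text \<open>
  If \<open>N\<close> is a Hermite normal form with pattern, conjugating it by an element \<open>g\<close> of its pattern
  group permutes indices inside blocks only, so the result is again in Hermite normal form; by
  uniqueness it is the Hermite normal form of \<open>N \<cdot> g\<^sup>-\<^sup>1\<close>. Hence the orbit of \<open>N\<^sub>0\<close> consists of the
  Hermite normal forms of all \<open>N\<^sub>0 \<cdot> h\<close> with \<open>h\<close> in the pattern group, and a column permutation taking
  \<open>A\<close> to \<open>N\<^sub>0\<close> only matters up to its right coset. Conjugation keeps the diagonal and therefore the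
  pattern group, so orbits are classes of an equivalence relation; this turns the condition
  that \<open>N\<^sub>0\<close> is the minimum of the orbit of \<open>H\<close> into \<open>H\<close> being a member of the orbit of \<open>N\<^sub>0\<close>.
\<close>

section \<open>Existence and uniqueness of the Hermite normal form\<close>

text \<open>The lattice is the invariant that left multiplication by unimodular matrices leaves
  unchanged. Vectors are plain functions of which only the first \<open>d\<close> values are
  constrained, so membership transfers along agreement on \<open>j < d\<close>.\<close>

definition row_lattice :: "nat \<Rightarrow> int mat \<Rightarrow> (nat \<Rightarrow> int) set" where
  "row_lattice d M = {v. \<exists>c. \<forall>j<d. v j = (\<Sum>i<d. c i * M $$ (i, j))}"

lemma row_lattice_diff:
  assumes "v \<in> row_lattice d M" "w \<in> row_lattice d M"
  shows "(\<lambda>j. v j - w j) \<in> row_lattice d M"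
proof -
  obtain a b where "\<forall>j<d. v j = (\<Sum>i<d. a i * M $$ (i, j))"
      "\<forall>j<d. w j = (\<Sum>i<d. b i * M $$ (i, j))"
    using assms by (auto simp: row_lattice_def)
  then show ?thesis
    unfolding row_lattice_def
    by (intro CollectI exI[of _ "\<lambda>i. a i - b i"]) (simp add: left_diff_distrib sum_subtractf)
qed

lemma row_lattice_smult:
  assumes "v \<in> row_lattice d M"
  shows "(\<lambda>j. x * v j) \<in> row_lattice d M"
proof -
  obtain a where "\<forall>j<d. v j = (\<Sum>i<d. a i * M $$ (i, j))"
    using assms by (auto simp: row_lattice_def)
  then show ?thesis
    unfolding row_lattice_def
    by (intro CollectI exI[of _ "\<lambda>i. x * a i"]) (simp add: sum_distrib_left mult.assoc)
qed

lemma row_lattice_sum: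
  assumes "\<And>k. k \<in> K \<Longrightarrow> f k \<in> row_lattice d M"
  shows "(\<lambda>j. \<Sum>k\<in>K. y k * f k j) \<in> row_lattice d M"
proof -
  obtain a where a: "\<And>k j. k \<in> K \<Longrightarrow> j < d \<Longrightarrow> f k j = (\<Sum>i<d. a k i * M $$ (i, j))"
    using assms unfolding row_lattice_def mem_Collect_eq by metis
  have "(\<Sum>k\<in>K. y k * f k j) = (\<Sum>i<d. (\<Sum>k\<in>K. y k * a k i) * M $$ (i, j))" if "j < d" for j
  proof -
    have "(\<Sum>k\<in>K. y k * f k j) = (\<Sum>k\<in>K. \<Sum>i<d. y k * a k i * M $$ (i, j))"
      using a that by (intro sum.cong) (auto simp: sum_distrib_left mult.assoc)
    also have "\<dots> = (\<Sum>i<d. \<Sum>k\<in>K. y k * a k i * M $$ (i, j))"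
      by (rule sum.swap)
    finally show ?thesis by (simp add: sum_distrib_right)
  qed
  then show ?thesis
    unfolding row_lattice_def by (intro CollectI exI[of _ "\<lambda>i. \<Sum>k\<in>K. y k * a k i"]) simp
qed

lemma row_lattice_row:
  assumes "k < d"
  shows "(\<lambda>j. M $$ (k, j)) \<in> row_lattice d M"
  unfolding row_lattice_def
  by (intro CollectI exI[of _ "\<lambda>i. if i = k then 1 else 0"])
    (use assms in \<open>simp add: if_distrib[of "\<lambda>x. x * _"] sum.delta cong: if_cong\<close>)

lemma mult_mat_entry:
  assumes "U \<in> carrier_mat d d" "M \<in> carrier_mat d d" "i < d" "j < d"
  shows "(U * M) $$ (i, j) = (\<Sum>k<d. U $$ (i, k) * M $$ (k, j))"
  using assms by (auto simp: scalar_prod_def lessThan_atLeast0 intro!: sum.cong)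

text \<open>The rows of \<open>U\<close> list the coefficients that express the rows of
  \<open>U * M\<close> through those of \<open>M\<close>. For unimodular \<open>U\<close> the same
  inclusion for the inverse gives equality of the lattices.\<close>

lemma row_lattice_mult_subset:
  assumes "U \<in> carrier_mat d d" "M \<in> carrier_mat d d"
  shows "row_lattice d (U * M) \<subseteq> row_lattice d M"
proof
  fix v assume "v \<in> row_lattice d (U * M)"
  then obtain c where c: "\<And>j. j < d \<Longrightarrow> v j = (\<Sum>i<d. c i * (U * M) $$ (i, j))"
    by (auto simp: row_lattice_def)
  have "(\<lambda>j. \<Sum>i<d. c i * (\<Sum>k<d. U $$ (i, k) * M $$ (k, j))) \<in> row_lattice d M"
    by (intro row_lattice_sum row_lattice_row) auto
  moreover have "v j = (\<Sum>i<d. c i * (\<Sum>k<d. U $$ (i, k) * M $$ (k, j)))" if "j < d" for j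
    unfolding c[OF that] using that
    by (intro sum.cong) (auto simp: mult_mat_entry[OF assms])
  ultimately show "v \<in> row_lattice d M"
    by (auto simp: row_lattice_def)
qed

text \<open>The coefficient vectors of the individual rows are stacked to form \<open>U\<close>.
  Invertibility of \<open>U\<close> is not claimed here; it comes from a determinant argument once
  there are factors in both directions.\<close>

lemma rows_in_row_lattice_imp_mult:
  assumes N: "N \<in> carrier_mat d d" and M: "M \<in> carrier_mat d d"
    and rows: "\<And>k. k < d \<Longrightarrow> (\<lambda>j. N $$ (k, j)) \<in> row_lattice d M"
  shows "\<exists>U \<in> carrier_mat d d. N = U * M"
proof -
  obtain c where c: "\<And>k j. k < d \<Longrightarrow> j < d \<Longrightarrow> N $$ (k, j) = (\<Sum>i<d. c k i * M $$ (i, j))"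
    using rows unfolding row_lattice_def mem_Collect_eq by metis
  let ?U = "mat d d (\<lambda>(k, i). c k i)"
  have "N = ?U * M"
  proof (rule eq_matI)
    fix i j assume "i < dim_row (?U * M)" "j < dim_col (?U * M)"
    then show "N $$ (i, j) = (?U * M) $$ (i, j)"
      using M by (simp add: mult_mat_entry[OF _ M] c del: index_mult_mat(1))
  qed (use N M in auto)
  then show ?thesis by (intro bexI[of _ ?U]) auto
qed

section \<open>Unimodular integer matrices\<close>

lemma GL_int_iff:
  "U \<in> GL_int d \<longleftrightarrow>
    U \<in> carrier_mat d d \<and> (\<exists>V \<in> carrier_mat d d. U * V = 1\<^sub>m d \<and> V * U = 1\<^sub>m d)"
proof
  assume "U \<in> GL_int d"
  then have U: "U \<in> carrier_mat d d" and "invertible_mat U"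
    by (auto simp: GL_int_def)
  then obtain V where V: "U * V = 1\<^sub>m d" "V * U = 1\<^sub>m (dim_row V)"
    by (auto simp: invertible_mat_def inverts_mat_def)
  \<comment> \<open>\<open>invertible_mat\<close> gives an inverse without stated dimensions;
    comparing the column counts in the two identities fixes them.\<close>
  have "dim_col V = d" using arg_cong[OF V(1), of dim_col] by simp
  moreover have "dim_row V = d" using arg_cong[OF V(2), of dim_col] U by simp
  ultimately show "U \<in> carrier_mat d d \<and> (\<exists>V \<in> carrier_mat d d. U * V = 1\<^sub>m d \<and> V * U = 1\<^sub>m d)"
    using U V by auto
qed (auto simp: GL_int_def invertible_mat_def inverts_mat_def)

lemma GL_intI:
  assumes "U \<in> carrier_mat d d" "V \<in> carrier_mat d d" "U * V = 1\<^sub>m d" "V * U = 1\<^sub>m d"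
  shows "U \<in> GL_int d"
  using assms GL_int_iff by blast

lemma GL_intE:
  assumes "U \<in> GL_int d"
  obtains V where "U \<in> carrier_mat d d" "V \<in> carrier_mat d d" "U * V = 1\<^sub>m d" "V * U = 1\<^sub>m d"
    "V \<in> GL_int d"
  using assms GL_int_iff by metis

lemma GL_int_mult:
  assumes "U \<in> GL_int d" "V \<in> GL_int d"
  shows "U * V \<in> GL_int d"
proof -
  from assms(1) obtain U' where U: "U \<in> carrier_mat d d" "U' \<in> carrier_mat d d"
    "U * U' = 1\<^sub>m d" "U' * U = 1\<^sub>m d" by (rule GL_intE)
  from assms(2) obtain V' where V: "V \<in> carrier_mat d d" "V' \<in> carrier_mat d d"
    "V * V' = 1\<^sub>m d" "V' * V = 1\<^sub>m d" by (rule GL_intE)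
  show ?thesis
  proof (rule GL_intI)
    have "V * (V' * U') = U'" "U' * (U * V) = V"
      using U V by (simp_all add: assoc_mult_mat[of _ d d _ d _ d, symmetric])
    then show "U * V * (V' * U') = 1\<^sub>m d" "V' * U' * (U * V) = 1\<^sub>m d"
      using U V by (simp_all add: assoc_mult_mat[of _ d d _ d _ d] mult_carrier_mat[of _ d d _ d])
  qed (use U V in auto)
qed

lemma smult_smult_one_mat:
  fixes x y :: int
  assumes "x * y = 1"
  shows "x \<cdot>\<^sub>m (y \<cdot>\<^sub>m 1\<^sub>m d) = 1\<^sub>m d"
  using assms by (intro eq_matI) auto

text \<open>Cramer's rule: when the determinant is a unit with inverse \<open>x\<close>, the
  adjugate scaled by \<open>x\<close> is an integral inverse.\<close>

lemma GL_int_of_det: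
  assumes U: "U \<in> carrier_mat d d" and x: "x * det U = 1"
  shows "U \<in> GL_int d"
proof (rule GL_intI[OF U])
  show "x \<cdot>\<^sub>m adj_mat U \<in> carrier_mat d d" using adj_mat(1)[OF U] by simp
  show "U * (x \<cdot>\<^sub>m adj_mat U) = 1\<^sub>m d"
    using adj_mat(1,2)[OF U] U x by (simp add: mult_smult_distrib[of _ d d _ d] smult_smult_one_mat)
  show "x \<cdot>\<^sub>m adj_mat U * U = 1\<^sub>m d"
    using adj_mat(1,3)[OF U] U x by (simp add: mult_smult_assoc_mat[of _ d d _ d] smult_smult_one_mat)
qed

section \<open>Existence of the Hermite normal form\<close>

lemma smult_unit_in_row_lattice:
  assumes M: "M \<in> carrier_mat d d" and k: "k < d"
  shows "(\<lambda>j. if j = k then det M else 0) \<in> row_lattice d M"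
proof -
  have "(if j = k then det M else 0) = (\<Sum>i<d. adj_mat M $$ (k, i) * M $$ (i, j))" if "j < d" for j
  proof -
    have "(adj_mat M * M) $$ (k, j) = (if j = k then det M else 0)"
      unfolding adj_mat(3)[OF M] using that k by simp
    then show ?thesis using mult_mat_entry[OF adj_mat(1)[OF M] M k that] by simp
  qed
  then show ?thesis by (auto simp: row_lattice_def)
qed

text \<open>Division with remainder, one column at a time from left to right: row \<open>n\<close>
  vanishes left of column \<open>n\<close>, so subtracting a multiple of it keeps the columns
  already reduced. The lower bound \<open>a\<close> allows both reducing a row by the rows below it
  and reducing an arbitrary vector by all rows.\<close>

lemma triangular_reduction:
  fixes t :: "nat \<Rightarrow> nat \<Rightarrow> int" and x :: "nat \<Rightarrow> int"
  assumes "\<And>j. j < d \<Longrightarrow> 0 < t j j" "\<And>i j. j < i \<Longrightarrow> i < d \<Longrightarrow> t i j = 0"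
  shows "\<exists>y. \<forall>j \<in> {a..<d}. 0 \<le> x j - (\<Sum>i\<in>{a..<d}. y i * t i j) \<and>
    x j - (\<Sum>i\<in>{a..<d}. y i * t i j) < t j j"
proof -
  have "\<exists>y. \<forall>j \<in> {a..<n}. 0 \<le> x j - (\<Sum>i\<in>{a..<n}. y i * t i j) \<and>
    x j - (\<Sum>i\<in>{a..<n}. y i * t i j) < t j j" if "n \<le> d" for n
    using that
  proof (induction n)
    case (Suc n)
    then obtain y where y: "\<And>j. j \<in> {a..<n} \<Longrightarrow> 0 \<le> x j - (\<Sum>i\<in>{a..<n}. y i * t i j) \<and>
      x j - (\<Sum>i\<in>{a..<n}. y i * t i j) < t j j"
      using Suc_leD by blast
    show ?case
    proof (cases "a \<le> n")
      case True
      \<comment> \<open>\<open>z\<close> is what is left in column \<open>n\<close> after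
        subtracting the earlier rows; its quotient by the pivot is the new coefficient and its
        remainder the new entry.\<close>
      define z where "z = x n - (\<Sum>i\<in>{a..<n}. y i * t i n)"
      have tn: "0 < t n n" using assms(1) Suc.prems by simp
      have sum_upd: "(\<Sum>i\<in>{a..<Suc n}. (y(n := z div t n n)) i * t i j)
          = (\<Sum>i\<in>{a..<n}. y i * t i j) + z div t n n * t n j" for j
        using True by simp
      have "0 \<le> x j - (\<Sum>i\<in>{a..<Suc n}. (y(n := z div t n n)) i * t i j) \<and>
        x j - (\<Sum>i\<in>{a..<Suc n}. (y(n := z div t n n)) i * t i j) < t j j"
        if j: "j \<in> {a..<Suc n}" for j
      proof (cases "j = n")
        case True
        have "x j - (\<Sum>i\<in>{a..<Suc n}. (y(n := z div t n n)) i * t i j) = z mod t n n"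
          unfolding sum_upd using True by (simp add: z_def minus_div_mult_eq_mod[symmetric])
        then show ?thesis using tn True by simp
      next
        case False
        then have "t n j = 0" using assms(2) j Suc.prems by simp
        then show ?thesis unfolding sum_upd using y[of j] j False by simp
      qed
      then show ?thesis by blast
    qed simp
  qed simp
  then show ?thesis by blast
qed

text \<open>By well-ordering, among the lattice vectors that vanish before position \<open>k\<close>
  and are positive there, one has the least entry at \<open>k\<close>.\<close>

lemma row_lattice_minimal_rows:
  assumes M: "M \<in> carrier_mat d d" "det M \<noteq> 0"
  obtains t where "\<And>k. k < d \<Longrightarrow> t k \<in> row_lattice d M"
    "\<And>k. k < d \<Longrightarrow> 0 < t k k" "\<And>k j. j < k \<Longrightarrow> k < d \<Longrightarrow> t k j = 0"
    "\<And>k v. k < d \<Longrightarrow> v \<in> row_lattice d M \<Longrightarrow> \<forall>j<k. v j = 0 \<Longrightarrow> 0 < v k \<Longrightarrow> t k k \<le> v k"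
proof -
  define S where "S k = {v \<in> row_lattice d M. (\<forall>j<k. v j = 0) \<and> 0 < v k}" for k
  have "\<exists>v. v \<in> S k \<and> (\<forall>w. w \<in> S k \<longrightarrow> nat (v k) \<le> nat (w k))" if k: "k < d" for k
  proof (rule ex_has_least_nat[of "\<lambda>v. v \<in> S k" _ "\<lambda>v. nat (v k)"])
    \<comment> \<open>Nonemptiness of \<open>S k\<close>: the adjugate yields \<open>det M\<close>
      times a unit vector, and the sign makes its entry positive.\<close>
    have "(\<lambda>j. sgn (det M) * (if j = k then det M else 0)) \<in> row_lattice d M"
      by (rule row_lattice_smult[OF smult_unit_in_row_lattice[OF M(1) k]])
    then show "(\<lambda>j. sgn (det M) * (if j = k then det M else 0)) \<in> S k"
      using M(2) by (auto simp: S_def sgn_if)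
  qed
  then obtain t where t: "\<And>k. k < d \<Longrightarrow> t k \<in> S k"
      "\<And>k w. k < d \<Longrightarrow> w \<in> S k \<Longrightarrow> nat (t k k) \<le> nat (w k)"
    by metis
  show thesis
  proof (rule that[of t])
    fix k v assume a: "k < d" "v \<in> row_lattice d M" "\<forall>j<k. v j = 0" "0 < v k"
    then have "nat (t k k) \<le> nat (v k)" by (intro t(2)) (auto simp: S_def)
    then show "t k k \<le> v k" using a(4) by simp
  qed (use t(1) in \<open>auto simp: S_def\<close>)
qed

text \<open>The minimal rows are triangular, and reducing each by those below it gives a Hermite
  form \<open>N\<close> with rows in the lattice of \<open>M\<close>. Minimality also puts the rows
  of \<open>M\<close> in the lattice of \<open>N\<close>, so \<open>N = U * M\<close> and
  \<open>M = V * N\<close>; cancelling \<open>det M\<close> leaves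
  \<open>det V * det U = 1\<close>.\<close>

lemma hermite_exists:
  assumes M: "M \<in> carrier_mat d d" "det M \<noteq> 0"
  shows "\<exists>N. is_hermite N \<and> (\<exists>U \<in> GL_int d. N = U * M)"
proof -
  obtain t where tL: "\<And>k. k < d \<Longrightarrow> t k \<in> row_lattice d M"
    and tpos: "\<And>k. k < d \<Longrightarrow> 0 < t k k" and t0: "\<And>k j. j < k \<Longrightarrow> k < d \<Longrightarrow> t k j = 0"
    and tmin: "\<And>k v. k < d \<Longrightarrow> v \<in> row_lattice d M \<Longrightarrow> \<forall>j<k. v j = 0 \<Longrightarrow> 0 < v k
      \<Longrightarrow> t k k \<le> v k"
    using row_lattice_minimal_rows[OF M] by blast
  \<comment> \<open>Starting at \<open>Suc k\<close> uses only the rows below row \<open>k\<close>;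
    these vanish in columns up to \<open>k\<close>, so the pivot and the zeros before it
    survive.\<close>
  have "\<forall>k. \<exists>y. \<forall>j \<in> {Suc k..<d}. 0 \<le> t k j - (\<Sum>i\<in>{Suc k..<d}. y i * t i j) \<and>
    t k j - (\<Sum>i\<in>{Suc k..<d}. y i * t i j) < t j j"
    by (intro allI triangular_reduction) (use tpos t0 in auto)
  from choice[OF this] obtain y where y: "\<And>k j. j \<in> {Suc k..<d} \<Longrightarrow>
    0 \<le> t k j - (\<Sum>i\<in>{Suc k..<d}. y k i * t i j) \<and>
    t k j - (\<Sum>i\<in>{Suc k..<d}. y k i * t i j) < t j j" by blast
  define h where "h k j = t k j - (\<Sum>i\<in>{Suc k..<d}. y k i * t i j)" for k j
  have h_low: "h k j = t k j" if "j \<le> k" for k j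
    unfolding h_def using t0 that by (simp add: sum.neutral)
  have hL: "h k \<in> row_lattice d M" if "k < d" for k
    unfolding h_def using that tL by (intro row_lattice_diff row_lattice_sum) auto
  define N where "N = mat d d (\<lambda>(k, j). h k j)"
  have N: "N \<in> carrier_mat d d" by (simp add: N_def)
  have herm: "is_hermite N"
    using tpos t0 y by (auto simp: is_hermite_def N_def h_low) (auto simp: h_def)
  have "(\<lambda>j. N $$ (k, j)) \<in> row_lattice d M" if "k < d" for k
    using hL[OF that] that by (auto simp: N_def row_lattice_def)
  then obtain U where U: "U \<in> carrier_mat d d" "N = U * M"
    using rows_in_row_lattice_imp_mult[OF N M(1)] by blast
  \<comment> \<open>A remainder modulo the rows of \<open>N\<close> vanishes, by minimality of the diagonal entries.\<close>
  have "v \<in> row_lattice d N" if v: "v \<in> row_lattice d M" for v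
  proof -
    have "\<exists>y. \<forall>j \<in> {0..<d}. 0 \<le> v j - (\<Sum>i\<in>{0..<d}. y i * h i j) \<and>
        v j - (\<Sum>i\<in>{0..<d}. y i * h i j) < h j j"
      by (rule triangular_reduction) (use tpos t0 h_low in auto)
    then obtain z where z: "\<And>j. j < d \<Longrightarrow> 0 \<le> v j - (\<Sum>i\<in>{0..<d}. z i * h i j) \<and>
        v j - (\<Sum>i\<in>{0..<d}. z i * h i j) < h j j"
      unfolding atLeast0LessThan by blast
    define w where "w j = v j - (\<Sum>i\<in>{0..<d}. z i * h i j)" for j
    have wL: "w \<in> row_lattice d M"
      unfolding w_def using v hL by (intro row_lattice_diff row_lattice_sum) auto
    have "w j = 0" if "j < d" for j
      using that
    proof (induction j rule: less_induct)
      case (less j)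
      have "0 \<le> w j" "w j < t j j" using z[OF less.prems] by (auto simp: w_def h_low)
      moreover have "\<not> 0 < w j" using tmin[OF less.prems wL] less \<open>w j < t j j\<close> by force
      ultimately show ?case by simp
    qed
    then have "\<forall>j<d. v j = (\<Sum>i<d. z i * N $$ (i, j))"
      by (auto simp: w_def N_def lessThan_atLeast0)
    then show ?thesis by (auto simp: row_lattice_def)
  qed
  then obtain V where V: "V \<in> carrier_mat d d" "M = V * N"
    using rows_in_row_lattice_imp_mult[OF M(1) N] row_lattice_row by blast
  have "det M = det V * (det U * det M)"
    using V U M(1) N det_mult by metis
  then have "det V * det U = 1" using M(2) by (simp add: mult.assoc[symmetric])
  then show ?thesis using herm U GL_int_of_det by blast
qed

section \<open>Uniqueness of the Hermite normal form\<close>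

lemma triangular_combination_leading:
  fixes N :: "int mat"
  assumes "\<And>k. k < d \<Longrightarrow> 0 < N $$ (k, k)" "\<And>i j. j < i \<Longrightarrow> i < d \<Longrightarrow> N $$ (i, j) = 0"
    and v: "v \<in> row_lattice d N" "k < d" "\<And>j. j < k \<Longrightarrow> v j = 0"
  shows "N $$ (k, k) dvd v k"
proof -
  obtain c where c: "\<And>j. j < d \<Longrightarrow> v j = (\<Sum>i<d. c i * N $$ (i, j))"
    using v by (auto simp: row_lattice_def)
  \<comment> \<open>In column \<open>n\<close> the rows after \<open>n\<close> vanish by
    triangularity and the rows before \<open>n\<close> have coefficient zero, so a single term
    survives. Applied from left to right, this kills all coefficients before
    \<open>k\<close>.\<close>
  have lead: "v n = c n * N $$ (n, n)" if "n < d" "\<And>i. i < n \<Longrightarrow> c i = 0" for n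
  proof -
    have "v n = (\<Sum>i\<in>{n}. c i * N $$ (i, n))"
      unfolding c[OF that(1)]
      by (rule sum.mono_neutral_right) (use that assms(2) in \<open>auto, metis linorder_neqE_nat\<close>)
    then show ?thesis by simp
  qed
  have "c n = 0" if "n < k" for n
    using that
  proof (induction n rule: less_induct)
    case (less n)
    then have "0 = c n * N $$ (n, n)" using lead[of n] v by simp
    then show ?case using assms(1)[of n] less.prems v(2) by simp
  qed
  then show ?thesis using lead[OF v(2)] by simp
qed

text \<open>Corresponding pivots divide each other, hence agree. The difference of two corresponding
  rows lies in the lattice, so its first entry that could be nonzero is a multiple of the pivot of
  its column; above the diagonal both entries lie between 0 and that pivot, which forces the
  difference to be 0.\<close>

lemma is_hermite_row_lattice_unique:
  assumes N: "N \<in> carrier_mat d d" "is_hermite N" and N': "N' \<in> carrier_mat d d" "is_hermite N'"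
    and eq: "row_lattice d N = row_lattice d N'"
  shows "N = N'"
proof -
  have pos: "\<And>k. k < d \<Longrightarrow> 0 < N $$ (k, k)" "\<And>k. k < d \<Longrightarrow> 0 < N' $$ (k, k)"
    and low: "\<And>i j. j < i \<Longrightarrow> i < d \<Longrightarrow> N $$ (i, j) = 0" "\<And>i j. j < i \<Longrightarrow> i < d \<Longrightarrow> N' $$ (i, j) = 0"
    and up: "\<And>i j. i < j \<Longrightarrow> j < d \<Longrightarrow> 0 \<le> N $$ (i, j) \<and> N $$ (i, j) < N $$ (j, j)"
      "\<And>i j. i < j \<Longrightarrow> j < d \<Longrightarrow> 0 \<le> N' $$ (i, j) \<and> N' $$ (i, j) < N' $$ (j, j)"
    using N N' by (auto simp: is_hermite_def upper_triangular_def)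
  have diag: "N $$ (k, k) = N' $$ (k, k)" if k: "k < d" for k
  proof (rule zdvd_antisym_nonneg)
    show "N $$ (k, k) dvd N' $$ (k, k)"
      using triangular_combination_leading[OF pos(1) low(1), of d "\<lambda>j. N' $$ (k, j)" k]
        row_lattice_row[OF k, of N'] eq k low(2) by auto
    show "N' $$ (k, k) dvd N $$ (k, k)"
      using triangular_combination_leading[OF pos(2) low(2), of d "\<lambda>j. N $$ (k, j)" k]
        row_lattice_row[OF k, of N] eq k low(1) by auto
  qed (use pos k in \<open>auto intro: less_imp_le\<close>)
  have entry: "N $$ (i, j) - N' $$ (i, j) = 0" if i: "i < d" and "j < d" for i j
    using that(2)
  proof (induction j rule: less_induct)
    case (less j)
    have "(\<lambda>j. N $$ (i, j) - N' $$ (i, j)) \<in> row_lattice d N"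
      using row_lattice_diff[OF row_lattice_row[OF i, of N]] row_lattice_row[OF i, of N'] eq by simp
    then have dvd: "N $$ (j, j) dvd N $$ (i, j) - N' $$ (i, j)"
      using triangular_combination_leading[OF pos(1) low(1), of d "\<lambda>j. N $$ (i, j) - N' $$ (i, j)" j]
        less by simp
    consider "j < i" | "j = i" | "i < j" by linarith
    then show ?case
    proof cases
      case 3
      have "\<bar>N $$ (i, j) - N' $$ (i, j)\<bar> < N $$ (j, j)"
        using up(1)[OF 3 less.prems] up(2)[OF 3 less.prems] diag[OF less.prems] by linarith
      then show ?thesis using dvd dvd_imp_le_int[of "N $$ (i, j) - N' $$ (i, j)" "N $$ (j, j)"] by linarith
    qed (use low i diag in auto)
  qed
  then show ?thesis using N(1) N'(1) by (intro eq_matI) auto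
qed

text \<open>Every candidate in the definite description has the row lattice of \<open>M\<close>, so
  lattice uniqueness settles the choice. This turns any unimodular multiple of \<open>M\<close> in
  Hermite form into the value of \<open>hermite M\<close>.\<close>

lemma hermite_eqI:
  assumes M: "M \<in> carrier_mat d d" and N: "is_hermite N" "U \<in> GL_int d" "N = U * M"
  shows "hermite M = N"
proof -
  have lat: "X \<in> carrier_mat d d \<and> row_lattice d X = row_lattice d M" if "V \<in> GL_int d" "X = V * M" for X V
  proof -
    from that(1) obtain W where W: "V \<in> carrier_mat d d" "W \<in> carrier_mat d d" "W * V = 1\<^sub>m d"
      by (rule GL_intE)
    have X: "X \<in> carrier_mat d d" using W M that by simp
    have "W * X = M" using W M that by (simp add: assoc_mult_mat[symmetric])
    then show ?thesis
      using row_lattice_mult_subset[OF W(1) M] row_lattice_mult_subset[OF W(2) X] X that by auto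
  qed
  have "dim_row M = d" using M by simp
  then show ?thesis unfolding hermite_def
  proof (intro the_equality)
    show "is_hermite N \<and> (\<exists>U\<in>GL_int (dim_row M). N = U * M)" using N \<open>dim_row M = d\<close> by auto
    fix X assume X: "is_hermite X \<and> (\<exists>U\<in>GL_int (dim_row M). X = U * M)"
    then obtain V where "V \<in> GL_int d" "X = V * M" using \<open>dim_row M = d\<close> by auto
    then show "X = N" using is_hermite_row_lattice_unique lat N X by metis
  qed
qed

lemma hermiteE:
  assumes "M \<in> carrier_mat d d" "det M \<noteq> 0"
  obtains U where "U \<in> GL_int d" "is_hermite (hermite M)" "hermite M = U * M"
  using hermite_exists[OF assms] hermite_eqI[OF assms(1)] by metis

section \<open>Permutation matrices\<close>

lemma perm_mat_carrier [simp]: "perm_mat d \<sigma> \<in> carrier_mat d d"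
  by (simp add: perm_mat_def)

lemma perm_mat_GL_int:
  assumes "\<sigma> permutes {..<d}"
  shows "perm_mat d \<sigma> \<in> GL_int d"
  using perm_mat_inv[OF assms] by (intro GL_intI[of _ d "perm_mat d (Hilbert_Choice.inv \<sigma>)"]) auto

lemma mult_perm_mat_entry:
  assumes "M \<in> carrier_mat d d" "\<sigma> permutes {..<d}" "i < d" "j < d"
  shows "(M * perm_mat d \<sigma>) $$ (i, j) = M $$ (i, \<sigma> j)"
proof -
  have "\<sigma> j < d" using permutes_in_image[OF assms(2)] assms(4) by auto
  then show ?thesis
    using assms by (subst mult_mat_entry[OF assms(1) perm_mat_carrier assms(3,4)])
      (simp add: perm_mat_def sum.delta if_distrib[of "\<lambda>x. _ * x"] cong: if_cong)
qed

lemma perm_mat_mult_entry: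
  assumes "M \<in> carrier_mat d d" "\<sigma> permutes {..<d}" "i < d" "j < d"
  shows "(perm_mat d \<sigma> * M) $$ (i, j) = M $$ (Hilbert_Choice.inv \<sigma> i, j)"
proof -
  have lt: "Hilbert_Choice.inv \<sigma> i < d"
    using permutes_in_image[OF permutes_inv[OF assms(2)]] assms(3) by auto
  have "(perm_mat d \<sigma> * M) $$ (i, j) = (\<Sum>k<d. if k = Hilbert_Choice.inv \<sigma> i then M $$ (k, j) else 0)"
    using assms(3) permutes_inverses[OF assms(2)]
    by (subst mult_mat_entry[OF perm_mat_carrier assms(1,3,4)])
      (intro sum.cong, auto simp: perm_mat_def)
  then show ?thesis using lt by (simp add: sum.delta)
qed

lemma perm_mat_comp:
  assumes "\<sigma> permutes {..<d}" "\<tau> permutes {..<d}"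
  shows "perm_mat d (\<sigma> \<circ> \<tau>) = perm_mat d \<sigma> * perm_mat d \<tau>"
proof (rule eq_matI)
  fix i j assume "i < dim_row (perm_mat d \<sigma> * perm_mat d \<tau>)" "j < dim_col (perm_mat d \<sigma> * perm_mat d \<tau>)"
  then have ij: "i < d" "j < d" by (auto simp: perm_mat_def)
  moreover have "\<tau> j < d" using permutes_in_image[OF assms(2)] ij by auto
  ultimately show "perm_mat d (\<sigma> \<circ> \<tau>) $$ (i, j) = (perm_mat d \<sigma> * perm_mat d \<tau>) $$ (i, j)"
    by (subst mult_perm_mat_entry[OF perm_mat_carrier assms(2) ij]) (simp add: perm_mat_def)
qed (auto simp: perm_mat_def)

section \<open>Conjugation by permutation matrices, as a left action\<close>

definition conj_perm :: "(nat \<Rightarrow> nat) \<Rightarrow> int mat \<Rightarrow> int mat" where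
  "conj_perm g N = perm_mat (dim_row N) g * N * perm_mat (dim_row N) (Hilbert_Choice.inv g)"

lemma orbit_eq: "orbit N = (\<lambda>g. conj_perm g N) ` pattern_group N"
  by (auto simp: orbit_def conj_perm_def)

lemma conj_perm_carrier [simp]:
  "N \<in> carrier_mat d d \<Longrightarrow> conj_perm g N \<in> carrier_mat d d"
  by (auto simp: conj_perm_def perm_mat_def)

lemma conj_perm_entry:
  assumes "N \<in> carrier_mat d d" "g permutes {..<d}" "i < d" "j < d"
  shows "conj_perm g N $$ (i, j) = N $$ (Hilbert_Choice.inv g i, Hilbert_Choice.inv g j)"
proof -
  have lt: "Hilbert_Choice.inv g j < d"
    using permutes_in_image[OF permutes_inv[OF assms(2)]] assms(4) by auto
  have "perm_mat d g * N \<in> carrier_mat d d" using assms(1) by (auto simp: perm_mat_def)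
  then show ?thesis
    using assms lt
    by (simp add: conj_perm_def mult_perm_mat_entry permutes_inv perm_mat_mult_entry
        del: index_mult_mat(1))
qed

lemma conj_perm_comp:
  assumes N: "N \<in> carrier_mat d d" and g: "g permutes {..<d}" and h: "h permutes {..<d}"
  shows "conj_perm g (conj_perm h N) = conj_perm (g \<circ> h) N"
proof (rule eq_matI)
  fix i j assume "i < dim_row (conj_perm (g \<circ> h) N)" "j < dim_col (conj_perm (g \<circ> h) N)"
  then have ij: "i < d" "j < d" using conj_perm_carrier[OF N, of "g \<circ> h"] by auto
  moreover have "Hilbert_Choice.inv g i < d" "Hilbert_Choice.inv g j < d"
    using permutes_in_image[OF permutes_inv[OF g]] ij by auto
  moreover have "Hilbert_Choice.inv (g \<circ> h) = Hilbert_Choice.inv h \<circ> Hilbert_Choice.inv g"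
    using g h by (simp add: o_inv_distrib permutes_bij)
  ultimately show "conj_perm g (conj_perm h N) $$ (i, j) = conj_perm (g \<circ> h) N $$ (i, j)"
    using N g h by (simp add: conj_perm_entry[of _ d] permutes_compose)
qed (use N in \<open>auto simp: conj_perm_def perm_mat_def\<close>)

lemma conj_perm_inv:
  assumes "N \<in> carrier_mat d d" "g permutes {..<d}"
  shows "conj_perm (Hilbert_Choice.inv g) (conj_perm g N) = N"
proof -
  have "conj_perm (Hilbert_Choice.inv g) (conj_perm g N) = conj_perm id N"
    using conj_perm_comp[OF assms(1) permutes_inv[OF assms(2)] assms(2)] assms(2)
    by (simp add: permutes_inv_o)
  also have "\<dots> = N"
    using assms(1)
    by (intro eq_matI) (simp_all add: conj_perm_entry[of _ d] permutes_id, simp_all add: conj_perm_def perm_mat_def)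
  finally show ?thesis .
qed

section \<open>Pattern groups\<close>

text \<open>For a matrix with pattern this is the pattern group; it depends on the diagonal only, so
  that no uniqueness of the pattern is needed.\<close>

definition diag_group :: "nat \<Rightarrow> int mat \<Rightarrow> (nat \<Rightarrow> nat) set" where
  "diag_group d N = {g. g permutes {..<d} \<and>
     (\<forall>i<d. N $$ (g i, g i) = N $$ (i, i) \<and> (N $$ (i, i) = N $$ (d - 1, d - 1) \<longrightarrow> g i = i))}"

lemma sum_list_take_mono:
  fixes m :: "nat list"
  assumes "k \<le> l"
  shows "sum_list (take k m) \<le> sum_list (take l m)"
proof -
  have "take l m = take k m @ take (l - k) (drop k m)"
    using assms take_add[of k "l - k" m] by simp
  then show ?thesis by simp
qed

lemma block_lt:
  assumes "k < l" "i \<in> block m k" "j \<in> block m l"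
  shows "i < j"
  using assms sum_list_take_mono[of "Suc k" l m] by (auto simp: block_def)

lemma block_less_sum_list:
  assumes "i \<in> block m k"
  shows "i < sum_list m"
  \<comment> \<open>No bound on \<open>k\<close> is available, so the comparison is with a prefix of
    length at least \<open>Suc k\<close> that is nevertheless all of \<open>m\<close>.\<close>
  using assms sum_list_take_mono[of "Suc k" "max (Suc k) (length m)" m] by (auto simp: block_def)

lemma block_exists:
  assumes "i < sum_list m"
  shows "\<exists>k<length m. i \<in> block m k"
proof -
  have "\<exists>k<n. i \<in> block m k" if "i < sum_list (take n m)" for n
    using that
  proof (induction n)
    case (Suc n)
    then show ?case
      by (cases "i < sum_list (take n m)")
        (blast intro: less_SucI, auto simp: block_def intro!: exI[of _ n])
  qed simp
  from this[of "length m"] show ?thesis using assms by simp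
qed

text \<open>The entries of \<open>r\<close> are strictly increasing, hence distinct, so a diagonal
  value identifies its block. This lets blocks be read off the diagonal.\<close>

lemma mem_block_iff_diag:
  assumes N: "N \<in> block_mats r m" and k: "k < length m"
  shows "i \<in> block m k \<longleftrightarrow> i < sum_list m \<and> N $$ (i, i) = r ! k"
proof
  assume "i \<in> block m k"
  then show "i < sum_list m \<and> N $$ (i, i) = r ! k"
    using N k block_less_sum_list by (auto simp: block_mats_def)
next
  assume i: "i < sum_list m \<and> N $$ (i, i) = r ! k"
  then obtain l where l: "l < length m" "i \<in> block m l" using block_exists by blast
  then have "r ! l = r ! k" using N i by (auto simp: block_mats_def)
  moreover have "distinct r" "length r = length m"
    using N by (auto simp: block_mats_def strict_sorted_iff)
  ultimately show "i \<in> block m k" using l k by (metis nth_eq_iff_index_eq)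
qed

text \<open>Preserving every block amounts to preserving the diagonal values, and acting trivially
  on the last block amounts to fixing the indices that carry the final diagonal value.\<close>

lemma block_group_eq_diag_group:
  assumes N: "N \<in> block_mats r m"
  shows "block_group m = diag_group (sum_list m) N"
proof -
  define d where "d = sum_list m"
  let ?E = "\<Union>k<length m - 1. block m k"
  note diag = mem_block_iff_diag[OF N, folded d_def]
  have mpos: "\<forall>x \<in> set m. 0 < x" using N by (simp add: block_mats_def)
  \<comment> \<open>The last block has positive size, so it contains the final index
    \<open>d - 1\<close>, whose diagonal entry serves as its label.\<close>
  have last: "i \<notin> ?E \<longleftrightarrow> N $$ (i, i) = N $$ (d - 1, d - 1)" if i: "i < d" for i
  proof -
    have ne: "m \<noteq> []" using i by (auto simp: d_def)
    then have "d = sum_list (take (length m - 1) m) + last m"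
      unfolding d_def by (metis append_butlast_last_id butlast_conv_take sum_list.append
          sum_list.Cons sum_list.Nil add.right_neutral)
    moreover have "0 < last m" using mpos ne by simp
    ultimately have "d - 1 \<in> block m (length m - 1)"
      using ne by (auto simp: block_def d_def)
    then have r: "N $$ (d - 1, d - 1) = r ! (length m - 1)"
      using diag ne by simp
    have "i \<notin> ?E \<longleftrightarrow> i \<in> block m (length m - 1)"
    proof
      assume "i \<notin> ?E"
      moreover obtain k where "k < length m" "i \<in> block m k"
        using block_exists i by (auto simp: d_def)
      ultimately show "i \<in> block m (length m - 1)"
        by (cases "k = length m - 1") auto
    qed (use block_lt in blast)
    also have "\<dots> \<longleftrightarrow> N $$ (i, i) = r ! (length m - 1)"
      using diag[of "length m - 1"] ne i by simp
    finally show ?thesis using r by simp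
  qed
  have "g \<in> diag_group d N" if g: "g \<in> block_group m" for g
  proof -
    have E: "g permutes ?E" and im: "\<And>k. k < length m - 1 \<Longrightarrow> g ` block m k = block m k"
      using g by (auto simp: block_group_def)
    have "?E \<subseteq> {..<d}" using block_less_sum_list by (auto simp: d_def)
    then have "g permutes {..<d}" using E by (rule permutes_subset[rotated])
    moreover have "N $$ (g i, g i) = N $$ (i, i)" if i: "i < d" for i
    proof (cases "i \<in> ?E")
      case True
      then obtain k where k: "k < length m - 1" "i \<in> block m k" by auto
      then have "g i \<in> block m k" using im by blast
      then show ?thesis using k diag[of k] by simp
    qed (use permutes_not_in[OF E] in simp)
    moreover have "g i = i" if "i < d" "N $$ (i, i) = N $$ (d - 1, d - 1)" for i
      using last that permutes_not_in[OF E] by blast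
    ultimately show ?thesis by (simp add: diag_group_def)
  qed
  moreover have "g \<in> block_group m" if g: "g \<in> diag_group d N" for g
  proof -
    have p: "g permutes {..<d}" and gd: "\<And>i. i < d \<Longrightarrow> N $$ (g i, g i) = N $$ (i, i)"
      and fix_last: "\<And>i. i < d \<Longrightarrow> N $$ (i, i) = N $$ (d - 1, d - 1) \<Longrightarrow> g i = i"
      using g by (auto simp: diag_group_def)
    have "g permutes ?E"
      by (rule permutes_superset[OF p]) (use last fix_last in blast)
    \<comment> \<open>Only the inclusion needs an argument: an injective self-map of a finite set is
      onto.\<close>
    moreover have "g ` block m k = block m k" if k: "k < length m - 1" for k
    proof (rule endo_inj_surj)
      show "finite (block m k)" by (simp add: block_def)
      show "inj_on g (block m k)" using permutes_inj[OF p] inj_on_subset by blast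
      show "g ` block m k \<subseteq> block m k"
        using k gd permutes_in_image[OF p] by (auto simp: diag[of k])
    qed
    ultimately show ?thesis by (simp add: block_group_def)
  qed
  ultimately show ?thesis by (auto simp: d_def)
qed

text \<open>The definition ranges over all \<open>r\<close> and \<open>m\<close> fitting
  \<open>N\<close>; each choice yields the same \<open>diag_group\<close>, and
  \<open>has_pattern\<close> supplies at least one.\<close>

lemma pattern_group_eq_diag_group:
  assumes "has_pattern N" "N \<in> carrier_mat d d"
  shows "pattern_group N = diag_group d N"
proof -
  have "sum_list m = d" if "N \<in> block_mats r m" for r m
    using that assms(2) by (auto simp: block_mats_def)
  then show ?thesis
    using assms(1) block_group_eq_diag_group
    unfolding pattern_group_def has_pattern_def by blast
qed

lemma diag_group_id: "id \<in> diag_group d N"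
  by (simp add: diag_group_def permutes_id)

lemma diag_group_inv:
  assumes "g \<in> diag_group d N"
  shows "Hilbert_Choice.inv g \<in> diag_group d N"
proof -
  have p: "g permutes {..<d}" using assms by (simp add: diag_group_def)
  have "N $$ (Hilbert_Choice.inv g i, Hilbert_Choice.inv g i) = N $$ (i, i) \<and>
      (N $$ (i, i) = N $$ (d - 1, d - 1) \<longrightarrow> Hilbert_Choice.inv g i = i)" if "i < d" for i
  proof -
    have "Hilbert_Choice.inv g i < d" using permutes_in_image[OF permutes_inv[OF p]] that by auto
    then show ?thesis
      using assms that permutes_inverses[OF p] unfolding diag_group_def mem_Collect_eq by metis
  qed
  then show ?thesis using permutes_inv[OF p] by (simp add: diag_group_def)
qed

text \<open>Such a \<open>g\<close> moves indices only among equal diagonal values, so the diagonal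
  is unchanged, and the group is read off the diagonal.\<close>

lemma diag_group_conj_perm:
  assumes N: "N \<in> carrier_mat d d" and g: "g \<in> diag_group d N"
  shows "diag_group d (conj_perm g N) = diag_group d N"
proof -
  have "g permutes {..<d}" using g by (simp add: diag_group_def)
  then have diag: "conj_perm g N $$ (i, i) = N $$ (i, i)" if "i < d" for i
    using diag_group_inv[OF g] conj_perm_entry[OF N _ that that, of g] that
    by (simp add: diag_group_def)
  have "h \<in> diag_group d (conj_perm g N) \<longleftrightarrow> h \<in> diag_group d N" for h
  proof (cases "h permutes {..<d}")
    case True
    then have "h i < d" if "i < d" for i using permutes_in_image[OF True] that by auto
    then show ?thesis using True by (simp add: diag_group_def diag)
  qed (simp add: diag_group_def)
  then show ?thesis by blast
qed

section \<open>Patterns and Hermite forms under conjugation by the pattern group\<close>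

lemma diag_group_block:
  assumes N: "N \<in> block_mats r m" and g: "g \<in> diag_group (sum_list m) N"
    and i: "k < length m" "i \<in> block m k"
  shows "g i \<in> block m k"
proof -
  have p: "g permutes {..<sum_list m}" using g by (simp add: diag_group_def)
  have "i < sum_list m" "N $$ (i, i) = r ! k" using mem_block_iff_diag[OF N i(1)] i(2) by auto
  moreover from this have "g i < sum_list m" using permutes_in_image[OF p, of i] by simp
  ultimately show ?thesis
    using mem_block_iff_diag[OF N i(1)] g by (simp add: diag_group_def)
qed

lemma conj_perm_block_mats:
  assumes N: "N \<in> block_mats r m" and g: "g \<in> diag_group (sum_list m) N"
  shows "conj_perm g N \<in> block_mats r m"
proof -
  let ?h = "Hilbert_Choice.inv g"
  have p: "g permutes {..<sum_list m}" using g by (simp add: diag_group_def)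
  have N': "N \<in> carrier_mat (sum_list m) (sum_list m)" using N by (simp add: block_mats_def)
  have h: "?h i \<in> block m k" if "k < length m" "i \<in> block m k" for i k
    using diag_group_block[OF N diag_group_inv[OF g] that] .
  have "?h i = ?h j \<longleftrightarrow> i = j" for i j
    using permutes_inj[OF permutes_inv[OF p]] by (auto dest: injD)
  moreover have "conj_perm g N $$ (i, j) = N $$ (?h i, ?h j)" if "i \<in> block m k" "j \<in> block m l" for i j k l
    using conj_perm_entry[OF N' p] that block_less_sum_list by blast
  ultimately show ?thesis
    using N h conj_perm_carrier[OF N'] unfolding block_mats_def by simp
qed

text \<open>Inside a block the off-diagonal entries are zero, so reordering there is harmless.
  Between different blocks the order of indices survives, so an entry above the diagonal comes from
  one above the diagonal of \<open>N\<close> and inherits its bounds.\<close>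

lemma conj_perm_is_hermite:
  assumes N: "is_hermite N" "N \<in> block_mats r m" and g: "g \<in> diag_group (sum_list m) N"
  shows "is_hermite (conj_perm g N)"
proof -
  define d where "d = sum_list m"
  let ?h = "Hilbert_Choice.inv g"
  have p: "g permutes {..<d}" using g by (simp add: diag_group_def d_def)
  have Nc: "N \<in> carrier_mat d d" using N by (simp add: block_mats_def d_def)
  have Cc: "conj_perm g N \<in> carrier_mat d d" using Nc by simp
  have Cb: "conj_perm g N \<in> block_mats r m" by (rule conj_perm_block_mats[OF N(2) g])
  have hd: "?h i < d" if "i < d" for i
    using permutes_in_image[OF permutes_inv[OF p]] that by auto
  have h: "?h i \<in> block m k" if "k < length m" "i \<in> block m k" for i k
    using diag_group_block[OF N(2) diag_group_inv[OF g] that] .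
  have entry: "conj_perm g N $$ (i, j) = N $$ (?h i, ?h j)" if "i < d" "j < d" for i j
    using conj_perm_entry[OF Nc p that] .
  have pos: "0 < N $$ (j, j)" if "j < d" for j
    using N(1) Nc that by (simp add: is_hermite_def)
  have low: "conj_perm g N $$ (i, j) = 0" if ij: "j < i" "i < d" for i j
  proof -
    obtain k l where k: "k < length m" "i \<in> block m k" and l: "l < length m" "j \<in> block m l"
      using block_exists[of i m] block_exists[of j m] ij by (auto simp: d_def)
    have "\<not> k < l" using block_lt k l ij by (meson less_asym)
    then consider "l < k" | "l = k" by linarith
    then show ?thesis using Cb k l ij by cases (auto simp: block_mats_def)
  qed
  have up: "0 \<le> conj_perm g N $$ (i, j) \<and> conj_perm g N $$ (i, j) < conj_perm g N $$ (j, j)"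
    if ij: "i < j" "j < d" for i j
  proof -
    obtain k l where k: "k < length m" "i \<in> block m k" and l: "l < length m" "j \<in> block m l"
      using block_exists[of i m] block_exists[of j m] ij by (auto simp: d_def)
    have "\<not> l < k" using block_lt k l ij by (meson less_asym)
    then consider "k < l" | "k = l" by linarith
    then show ?thesis
    proof cases
      case 1
      then have "?h i < ?h j" using block_lt h k l by blast
      then show ?thesis using N(1) Nc hd ij by (simp add: is_hermite_def entry)
    next
      case 2
      then have "conj_perm g N $$ (i, j) = 0" using Cb k l ij by (auto simp: block_mats_def)
      then show ?thesis using pos hd ij by (simp add: entry)
    qed
  qed
  show ?thesis
    using Cc low up pos hd unfolding is_hermite_def by (auto simp: entry)
qed

lemma has_pattern_conj_perm:
  assumes "has_pattern N" "N \<in> carrier_mat d d" "g \<in> pattern_group N"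
  shows "has_pattern (conj_perm g N)"
    and "is_hermite N \<Longrightarrow> is_hermite (conj_perm g N)"
    and "pattern_group (conj_perm g N) = pattern_group N"
proof -
  obtain r m where N: "N \<in> block_mats r m" using assms(1) by (auto simp: has_pattern_def)
  then have d: "sum_list m = d" using assms(2) by (auto simp: block_mats_def)
  have g: "g \<in> diag_group d N" using assms pattern_group_eq_diag_group by blast
  show pat: "has_pattern (conj_perm g N)"
    using conj_perm_block_mats[OF N] g d by (auto simp: has_pattern_def)
  show "is_hermite (conj_perm g N)" if "is_hermite N"
    using conj_perm_is_hermite[OF that N] g d by simp
  show "pattern_group (conj_perm g N) = pattern_group N"
    using diag_group_conj_perm[OF assms(2) g] assms pat pattern_group_eq_diag_group[of _ d] by simp
qed

section \<open>Group laws and orbits\<close>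

lemma pattern_group_props:
  assumes "has_pattern N" "N \<in> carrier_mat d d"
  shows "id \<in> pattern_group N"
    and "g \<in> pattern_group N \<Longrightarrow> g permutes {..<d}"
    and "g \<in> pattern_group N \<Longrightarrow> Hilbert_Choice.inv g \<in> pattern_group N"
    and "g \<in> pattern_group N \<Longrightarrow> h \<in> pattern_group N \<Longrightarrow> g \<circ> h \<in> pattern_group N"
proof -
  note eq = pattern_group_eq_diag_group[OF assms]
  show "id \<in> pattern_group N" using eq diag_group_id by simp
  show "g permutes {..<d}" if "g \<in> pattern_group N" using that eq by (simp add: diag_group_def)
  show "Hilbert_Choice.inv g \<in> pattern_group N" if "g \<in> pattern_group N"
    using that eq diag_group_inv by simp
  show "g \<circ> h \<in> pattern_group N" if "g \<in> pattern_group N" "h \<in> pattern_group N"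
  proof -
    from that have g: "g permutes {..<d}" "h permutes {..<d}" by (auto simp: eq diag_group_def)
    have "h i < d" if "i < d" for i using permutes_in_image[OF g(2), of i] that by simp
    then show ?thesis
      using that g by (simp add: eq diag_group_def permutes_compose)
  qed
qed

text \<open>Conjugation leaves the pattern group unchanged, and right translation by the inverse of
  \<open>g\<close> reparametrizes it.\<close>

lemma orbit_conj_perm:
  assumes N: "has_pattern N" "N \<in> carrier_mat d d" and g: "g \<in> pattern_group N"
  shows "orbit (conj_perm g N) = orbit N"
proof -
  note props = pattern_group_props[OF N]
  have sub: "(\<lambda>h. conj_perm h (conj_perm g N)) ` pattern_group N \<subseteq> orbit N"
    using props g conj_perm_comp[OF N(2)] by (auto simp: orbit_eq)
  moreover have "conj_perm h N \<in> (\<lambda>h. conj_perm h (conj_perm g N)) ` pattern_group N"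
    if h: "h \<in> pattern_group N" for h
  proof
    show "h \<circ> Hilbert_Choice.inv g \<in> pattern_group N" using props g h by blast
    have "h \<circ> Hilbert_Choice.inv g \<circ> g = h"
      using permutes_inv_o(2)[OF props(2)[OF g]] by (simp add: comp_assoc)
    then show "conj_perm h N = conj_perm (h \<circ> Hilbert_Choice.inv g) (conj_perm g N)"
      using conj_perm_comp[OF N(2) props(2) props(2)[OF g], of "h \<circ> Hilbert_Choice.inv g"]
        \<open>h \<circ> Hilbert_Choice.inv g \<in> pattern_group N\<close> by simp
  qed
  ultimately show ?thesis
    using has_pattern_conj_perm(3)[OF N g] by (auto simp: orbit_eq)
qed

text \<open>Forwards, \<open>H\<close> shares its group and its orbit with \<open>N\<^sub>0\<close>.
  Backwards, a minimum is a member, so \<open>N\<^sub>0\<close> is a conjugate of \<open>H\<close>,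
  and the inverse permutation lies in the common group.\<close>

lemma mem_orbit_iff_rblex_min:
  assumes N\<^sub>0: "has_pattern N\<^sub>0" "N\<^sub>0 \<in> carrier_mat d d" "is_rblex_min N\<^sub>0 (orbit N\<^sub>0)"
    and H: "H \<in> carrier_mat d d"
  shows "H \<in> orbit N\<^sub>0 \<longleftrightarrow>
    has_pattern H \<and> pattern_group H = pattern_group N\<^sub>0 \<and> is_rblex_min N\<^sub>0 (orbit H)"
proof
  assume "H \<in> orbit N\<^sub>0"
  then obtain h where "h \<in> pattern_group N\<^sub>0" "H = conj_perm h N\<^sub>0" by (auto simp: orbit_eq)
  then show "has_pattern H \<and> pattern_group H = pattern_group N\<^sub>0 \<and> is_rblex_min N\<^sub>0 (orbit H)"
    using has_pattern_conj_perm[OF N\<^sub>0(1,2)] orbit_conj_perm[OF N\<^sub>0(1,2)] N\<^sub>0(3) by simp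
next
  assume *: "has_pattern H \<and> pattern_group H = pattern_group N\<^sub>0 \<and> is_rblex_min N\<^sub>0 (orbit H)"
  then obtain h where h: "h \<in> pattern_group H" "N\<^sub>0 = conj_perm h H"
    by (auto simp: is_rblex_min_def orbit_eq)
  have p: "h permutes {..<d}" using pattern_group_props(2) * H h by blast
  have "H = conj_perm (Hilbert_Choice.inv h) N\<^sub>0" using conj_perm_inv[OF H p] h by simp
  moreover have "Hilbert_Choice.inv h \<in> pattern_group N\<^sub>0"
    using pattern_group_props(3)[OF N\<^sub>0(1,2)] * h by simp
  ultimately show "H \<in> orbit N\<^sub>0" by (auto simp: orbit_eq)
qed

section \<open>Column permutations and the criterion for UP-equivalence\<close>

lemma perm_cols_carrier:
  assumes "M \<in> carrier_mat d d"
  shows "perm_cols M \<sigma> = M * perm_mat d \<sigma>" "perm_cols M \<sigma> \<in> carrier_mat d d"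
  using assms by (auto simp: perm_cols_def perm_mat_def)

lemma det_perm_cols_nonzero:
  assumes M: "M \<in> carrier_mat d d" "det M \<noteq> 0" and \<sigma>: "\<sigma> permutes {..<d}"
  shows "det (perm_cols M \<sigma>) \<noteq> 0"
proof -
  have "det (perm_mat d \<sigma>) * det (perm_mat d (Hilbert_Choice.inv \<sigma>)) = 1"
    using perm_mat_inv(1)[OF \<sigma>] det_mult[OF perm_mat_carrier perm_mat_carrier] det_one by metis
  then have "det (perm_mat d \<sigma>) \<noteq> 0" by auto
  then show ?thesis
    using M by (simp add: perm_cols_carrier(1)[OF M(1)] det_mult[OF M(1) perm_mat_carrier])
qed

theorem theorem3p9:
  fixes d l :: nat and A B N\<^sub>0 :: "int mat" and g :: "nat \<Rightarrow> nat \<Rightarrow> nat"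
  assumes "A \<in> carrier_mat d d" and "det A \<noteq> 0"
    and "B \<in> carrier_mat d d" and "det B \<noteq> 0"
    and "N\<^sub>0 \<in> PH d B"
    and "right_coset_decomposition d (pattern_group N\<^sub>0) l g"
  shows "(UP_equiv d A B \<longleftrightarrow>
            (\<exists>i \<in> {1..l}. hermite (perm_cols A (Hilbert_Choice.inv (g i))) \<in> orbit N\<^sub>0)) \<and>
         ((\<exists>i \<in> {1..l}. hermite (perm_cols A (Hilbert_Choice.inv (g i))) \<in> orbit N\<^sub>0) \<longleftrightarrow>
            (\<exists>i \<in> {1..l}.
               has_pattern (hermite (perm_cols A (Hilbert_Choice.inv (g i)))) \<and>
               pattern_group (hermite (perm_cols A (Hilbert_Choice.inv (g i)))) = pattern_group N\<^sub>0 \<and>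
               is_rblex_min N\<^sub>0 (orbit (hermite (perm_cols A (Hilbert_Choice.inv (g i)))))))"
proof -
  note A = assms(1,2) and B = assms(3,4)
  note assoc = assoc_mult_mat[of _ d d _ d _ d] mult_carrier_mat[of _ d d _ d]
  note P = perm_mat_carrier[of d]
  let ?P = "perm_mat d" and ?inv = "Hilbert_Choice.inv :: (nat \<Rightarrow> nat) \<Rightarrow> nat \<Rightarrow> nat"
  from assms(5) obtain g\<^sub>0 where g0: "g\<^sub>0 permutes {..<d}" "N\<^sub>0 = hermite (perm_cols B g\<^sub>0)"
    and pat: "has_pattern N\<^sub>0" and min: "is_rblex_min N\<^sub>0 (orbit N\<^sub>0)"
    by (auto simp: PH_def)
  obtain V where V: "V \<in> GL_int d" "is_hermite N\<^sub>0" "N\<^sub>0 = V * (B * ?P g\<^sub>0)"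
    using hermiteE[OF perm_cols_carrier(2)[OF B(1)] det_perm_cols_nonzero[OF B g0(1)]] g0(2)
    by (metis perm_cols_carrier(1)[OF B(1)])
  have Vc: "V \<in> carrier_mat d d" using V(1) by (simp add: GL_int_def)
  have N0c: "N\<^sub>0 \<in> carrier_mat d d" using Vc B(1) unfolding V(3) by simp
  note props = pattern_group_props[OF pat N0c]
  have cosets: "{p. p permutes {..<d}} = (\<Union>i \<in> {1..l}. (\<lambda>h. h \<circ> g i) ` pattern_group N\<^sub>0)"
    using assms(6) by (simp add: right_coset_decomposition_def)
  have gi: "g i permutes {..<d}" if "i \<in> {1..l}" for i
  proof -
    \<comment> \<open>The identity of the pattern group puts each representative into its own coset,
      so it is a permutation.\<close>
    have "id \<circ> g i \<in> {p. p permutes {..<d}}" unfolding cosets using props(1) that by blast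
    then show ?thesis by simp
  qed
  have herm: "\<exists>U \<in> GL_int d. hermite (perm_cols A (?inv (g i))) = U * (A * ?P (?inv (g i)))"
    if "i \<in> {1..l}" for i
    using hermiteE[OF perm_cols_carrier(2)[OF A(1)] det_perm_cols_nonzero[OF A permutes_inv[OF gi[OF that]]]]
    by (metis perm_cols_carrier(1)[OF A(1)])
  have "\<exists>i \<in> {1..l}. hermite (perm_cols A (?inv (g i))) \<in> orbit N\<^sub>0" if "UP_equiv d A B"
  proof -
    from that obtain U \<sigma> where U: "U \<in> GL_int d" and \<sigma>: "\<sigma> permutes {..<d}"
      and UA: "U * A = B * ?P \<sigma>" by (auto simp: UP_equiv_def perm_cols_carrier(1)[OF B(1)])
    have Uc: "U \<in> carrier_mat d d" using U by (simp add: GL_int_def)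
    \<comment> \<open>Chosen so that the columns of \<open>A\<close> permuted by
      \<open>\<tau>\<close> match those of \<open>B\<close> permuted by \<open>g\<^sub>0\<close>, up
      to the unimodular \<open>U\<close>.\<close>
    define \<tau> where "\<tau> = ?inv \<sigma> \<circ> g\<^sub>0"
    have \<tau>: "\<tau> permutes {..<d}" unfolding \<tau>_def using \<sigma> g0 by (simp add: permutes_compose permutes_inv)
    have \<sigma>\<tau>: "\<sigma> \<circ> \<tau> = g\<^sub>0"
      unfolding \<tau>_def using permutes_inv_o(1)[OF \<sigma>] by (simp add: comp_assoc[symmetric])
    have "V * U * (A * ?P \<tau>) = V * (U * A * ?P \<tau>)" using Vc Uc A(1) by (simp add: assoc P)
    also have "\<dots> = V * (B * ?P (\<sigma> \<circ> \<tau>))"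
      unfolding UA using B(1) by (simp add: assoc P perm_mat_comp[OF \<sigma> \<tau>])
    finally have N0: "N\<^sub>0 = V * U * (A * ?P \<tau>)" using V(3) \<sigma>\<tau> by simp
    \<comment> \<open>The inverse is decomposed because right cosets put \<open>h\<close> on the
      left: from \<open>?inv \<tau> = h \<circ> g i\<close> it follows that
      \<open>\<tau> \<circ> h\<close> is the inverse of \<open>g i\<close>.\<close>
    have "?inv \<tau> \<in> {p. p permutes {..<d}}" using \<tau> permutes_inv by blast
    then obtain i h where i: "i \<in> {1..l}" and h: "h \<in> pattern_group N\<^sub>0" and \<tau>h: "?inv \<tau> = h \<circ> g i"
      unfolding cosets by blast
    have hp: "h permutes {..<d}" by (rule props(2)[OF h])
    have "\<tau> \<circ> h = ?inv (g i)"
    proof -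
      have "g i \<circ> (\<tau> \<circ> h) = ?inv h \<circ> (h \<circ> g i) \<circ> \<tau> \<circ> h"
        using permutes_inv_o(2)[OF hp] by (simp add: comp_assoc[symmetric])
      also have "\<dots> = id"
        using permutes_inv_o(2)[OF \<tau>] permutes_inv_o(2)[OF hp] \<tau>h[symmetric]
        by (simp add: comp_assoc)
      finally have "?inv (g i) \<circ> (g i \<circ> (\<tau> \<circ> h)) = ?inv (g i)" by simp
      then show ?thesis using permutes_inv_o(2)[OF gi[OF i]] by (simp add: comp_assoc[symmetric])
    qed
    then have Ph: "?P \<tau> * ?P h = ?P (?inv (g i))" using perm_mat_comp[OF \<tau> hp] by simp
    \<comment> \<open>The right factor of this conjugation changes \<open>\<tau>\<close> into the
      inverse of \<open>g i\<close>, while everything left of \<open>A\<close> stays unimodular. The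
      conjugate is still in Hermite form, so uniqueness identifies it.\<close>
    have "conj_perm (?inv h) N\<^sub>0 = ?P (?inv h) * N\<^sub>0 * ?P h"
      using N0c by (simp add: conj_perm_def permutes_inv_inv[OF hp])
    also have "\<dots> = ?P (?inv h) * (V * U) * (A * (?P \<tau> * ?P h))"
      unfolding N0 using Vc Uc A(1) by (simp add: assoc P)
    finally have "conj_perm (?inv h) N\<^sub>0 = ?P (?inv h) * (V * U) * perm_cols A (?inv (g i))"
      by (simp add: Ph perm_cols_carrier(1)[OF A(1)])
    moreover have "is_hermite (conj_perm (?inv h) N\<^sub>0)"
      using has_pattern_conj_perm(2)[OF pat N0c props(3)[OF h]] V(2) by simp
    moreover have "?P (?inv h) * (V * U) \<in> GL_int d"
      using perm_mat_GL_int[OF permutes_inv[OF hp]] U V(1) by (intro GL_int_mult)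
    ultimately have "hermite (perm_cols A (?inv (g i))) = conj_perm (?inv h) N\<^sub>0"
      using hermite_eqI[OF perm_cols_carrier(2)[OF A(1)]] by blast
    then show ?thesis using i props(3)[OF h] by (auto simp: orbit_eq)
  qed
  moreover have "UP_equiv d A B"
    if i: "i \<in> {1..l}" and orb: "hermite (perm_cols A (?inv (g i))) \<in> orbit N\<^sub>0" for i
  proof -
    obtain U where U: "U \<in> GL_int d" "hermite (perm_cols A (?inv (g i))) = U * (A * ?P (?inv (g i)))"
      using herm[OF i] by blast
    have Uc: "U \<in> carrier_mat d d" using U by (simp add: GL_int_def)
    obtain h where h: "h \<in> pattern_group N\<^sub>0" and eq: "U * (A * ?P (?inv (g i))) = conj_perm h N\<^sub>0"
      using orb U(2) by (auto simp: orbit_eq)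
    have hp: "h permutes {..<d}" by (rule props(2)[OF h])
    \<comment> \<open>Obtained by solving the orbit equation for \<open>U * A\<close>: the column
      permutations \<open>g\<^sub>0\<close>, \<open>?inv h\<close> and \<open>g i\<close> collect to
      the right of \<open>B\<close>.\<close>
    define \<rho> where "\<rho> = g\<^sub>0 \<circ> (?inv h \<circ> g i)"
    have hg: "?inv h \<circ> g i permutes {..<d}" using hp gi[OF i] by (simp add: permutes_compose permutes_inv)
    have \<rho>: "\<rho> permutes {..<d}" unfolding \<rho>_def using g0(1) hg by (simp add: permutes_compose)
    have "?P h * V \<in> GL_int d" using perm_mat_GL_int[OF hp] V(1) by (rule GL_int_mult)
    \<comment> \<open>\<open>Y\<close> cancels the factor \<open>?P h * V\<close> left of
      \<open>B\<close>, so \<open>Y * U\<close> becomes the unimodular witness.\<close>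
    then obtain Y where Y: "Y \<in> GL_int d" "Y \<in> carrier_mat d d" "Y * (?P h * V) = 1\<^sub>m d"
      by (metis GL_intE)
    have "U * A = U * (A * ?P (?inv (g i))) * ?P (g i)"
      using perm_mat_inv(2)[OF gi[OF i]] Uc A(1) by (simp add: assoc P)
    also have "\<dots> = ?P h * (V * (B * ?P g\<^sub>0)) * ?P (?inv h) * ?P (g i)"
      unfolding eq conj_perm_def using Vc V(3) by simp
    also have "\<dots> = ?P h * V * (B * (?P g\<^sub>0 * (?P (?inv h) * ?P (g i))))"
      using Vc B(1) by (simp add: assoc P)
    also have "?P g\<^sub>0 * (?P (?inv h) * ?P (g i)) = ?P \<rho>"
      unfolding \<rho>_def
      by (simp add: perm_mat_comp[OF g0(1) hg] perm_mat_comp[OF permutes_inv[OF hp] gi[OF i]])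
    finally have UA: "U * A = ?P h * V * (B * ?P \<rho>)" .
    have "Y * U * A = Y * (U * A)" using Y(2) Uc A(1) by (simp add: assoc)
    also have "\<dots> = Y * (?P h * V) * (B * ?P \<rho>)"
      unfolding UA using Y(2) Vc B(1) by (simp add: assoc P)
    finally have "Y * U * A = B * ?P \<rho>" using Y(3) B(1) by simp
    then show ?thesis
      unfolding UP_equiv_def perm_cols_carrier(1)[OF B(1)] using GL_int_mult[OF Y(1) U(1)] \<rho> by blast
  qed
  \<comment> \<open>The second equivalence holds for each \<open>i\<close> separately, with the same
    \<open>i\<close> on both sides.\<close>
  moreover have "hermite (perm_cols A (?inv (g i))) \<in> orbit N\<^sub>0 \<longleftrightarrow>
      has_pattern (hermite (perm_cols A (?inv (g i)))) \<and>
      pattern_group (hermite (perm_cols A (?inv (g i)))) = pattern_group N\<^sub>0 \<and>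
      is_rblex_min N\<^sub>0 (orbit (hermite (perm_cols A (?inv (g i)))))" if i: "i \<in> {1..l}" for i
  proof (rule mem_orbit_iff_rblex_min[OF pat N0c min])
    obtain U where "U \<in> GL_int d" "hermite (perm_cols A (?inv (g i))) = U * (A * ?P (?inv (g i)))"
      using herm[OF i] by blast
    then show "hermite (perm_cols A (?inv (g i))) \<in> carrier_mat d d"
      using A(1) by (simp add: GL_int_def mult_carrier_mat[of _ d d _ d])
  qed
  ultimately show ?thesis by blast
qed

end
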